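(* Let $n\in\mathbb{N}$ and let $\mathcal{F}$ be the set of all functions $[n]\to[n]$. Assume there exists an $s$-advice, $q$-query adaptive inversion algorithm $\mathsf{Inv}$ with linear preprocessing such that $\Pr_{f\leftarrow\mathcal{F},\,x\leftarrow[n]}[\mathsf{Inv}(f(x);f)\in f^{-1}(f(x))]\ge\alpha$, where $\alpha>0$, and let $\mathcal{Q}:=\{(\mathcal{X},\mathcal{Y}):\mathcal{X},\mathcal{Y}\subseteq[n],\ |\mathcal{X}\cap\mathcal{Y}|\le1\}$. Then for every $\varepsilon>0$ there exists a protocol that solves set disjointness with one-sided error $\varepsilon$ on all inputs in $\mathcal{Q}$, with communication complexity $O\!\left(\frac{\log\varepsilon}{\log(1-\alpha^2/8)}\cdot(s+q\log n)\right)$, where the hidden constant is independent of $n,s,q,\alpha,\varepsilon$.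
   Context: $[n]=\{1,\dots,n\}$; logarithms base 2; $f^{-1}(y)=\{x: f(x)=y\}$; functions in $\mathcal{F}$ are identified with vectors in $[n]^n$. An $s$-advice, $q$-query adaptive inverter is a pair of deterministic algorithms $\mathsf{Inv}=(\mathsf{Pre},\mathsf{Dec})$ with $\mathsf{Pre}:\mathcal{F}\to\{0,1\}^s$ and $\mathsf{Dec}^{(\cdot)}:[n]\times\{0,1\}^s\to[n]$ an oracle algorithm making up to $q$ possibly adaptive queries; $\mathsf{Inv}(y;f):=\mathsf{Dec}^f(y,\mathsf{Pre}(f))$. $\mathsf{Pre}$ is linear if there exist an additive group $\mathcal{G}\subseteq\{0,1\}^s$ containing $\mathsf{Pre}(\mathcal{F})$ and an additive group $\mathcal{K}$ of size $n$ on $[n]$ such that $\mathsf{Pre}(f_1+_{\mathcal{K}}f_2)=\mathsf{Pre}(f_1)+_{\mathcal{G}}\mathsf{Pre}(f_2)$ for all $f_1,f_2$, with $+_{\mathcal{K}}$ applied coordinate-wise. Set disjointness: party $\mathsf{A}$ holds $\mathcal{X}\subseteq[n]$, party $\mathsf{B}$ holds $\mathcal{Y}\subseteq[n]$; a protocol $(\mathsf{A},\mathsf{B})$ using private randomness $r_{\mathsf{A}},r_{\mathsf{B}}$ and public randomness $r_p$ solves set disjointness with error $\varepsilon$ over all inputs in $\mathcal{Q}$ if for every $(\mathcal{X},\mathcal{Y})\in\mathcal{Q}$, with probability at least $1-\varepsilon$ over $r_{\mathsf{A}},r_{\mathsf{B}},r_p$ both parties output $\delta_{\mathcal{X},\mathcal{Y}}$,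 the indicator of $\mathcal{X}\cap\mathcal{Y}=\emptyset$. One-sided error means that on inputs with $\mathcal{X}\cap\mathcal{Y}=\emptyset$ both parties output the correct answer with probability $1$. The communication complexity is the maximal number of bits exchanged over all inputs and randomness.
   Formalization: In the bound each of the two factors, log ε/log(1−α²/8) and s+q log n, is replaced by its maximum with 1; the literal bound fails when s=q=0 (constant inverter), when n=1 and s=0, or when ε is near or above 1, since for ε<1 at least one bit must be sent. *)

theory Defs
  imports "HOL-Probability.Probability_Mass_Function" "HOL-Algebra.Group"
begin

section \<open>Function inversion with advice\<close>

definition funs :: "nat \<Rightarrow> (nat \<Rightarrow> nat) set" where
  "funs n = {1..n} \<rightarrow>\<^sub>E {1..n}"

text \<open>A deterministic adaptive oracle computation (of unbounded computational power) is a
  decision tree; the continuation after a query may depend on its answer.\<close>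

datatype oracle_tree = Answer nat | Query nat "nat \<Rightarrow> oracle_tree"

primrec result :: "(nat \<Rightarrow> nat) \<Rightarrow> oracle_tree \<Rightarrow> nat" where
  "result f (Answer x) = x"
| "result f (Query i k) = result f (k (f i))"

primrec queries :: "(nat \<Rightarrow> nat) \<Rightarrow> oracle_tree \<Rightarrow> nat list" where
  "queries f (Answer x) = []"
| "queries f (Query i k) = i # queries f (k (f i))"

definition inverter ::
  "nat \<Rightarrow> nat \<Rightarrow> nat \<Rightarrow> ((nat \<Rightarrow> nat) \<Rightarrow> bool list) \<Rightarrow> (nat \<Rightarrow> bool list \<Rightarrow> oracle_tree) \<Rightarrow> bool"
where
  "inverter n s q Pre Dec \<longleftrightarrow>
     (\<forall>f\<in>funs n. length (Pre f) = s) \<and>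
     (\<forall>f\<in>funs n. \<forall>y\<in>{1..n}. \<forall>a. length a = s \<longrightarrow>
        set (queries f (Dec y a)) \<subseteq> {1..n} \<and>
        length (queries f (Dec y a)) \<le> q \<and>
        result f (Dec y a) \<in> {1..n})"

definition invert ::
  "((nat \<Rightarrow> nat) \<Rightarrow> bool list) \<Rightarrow> (nat \<Rightarrow> bool list \<Rightarrow> oracle_tree) \<Rightarrow> nat \<Rightarrow> (nat \<Rightarrow> nat) \<Rightarrow> nat"
where
  "invert Pre Dec y f = result f (Dec y (Pre f))"

definition preimage :: "nat \<Rightarrow> (nat \<Rightarrow> nat) \<Rightarrow> nat \<Rightarrow> nat set" where
  "preimage n f y = {x\<in>{1..n}. f x = y}"

definition success_prob ::
  "nat \<Rightarrow> ((nat \<Rightarrow> nat) \<Rightarrow> bool list) \<Rightarrow> (nat \<Rightarrow> bool list \<Rightarrow> oracle_tree) \<Rightarrow> real"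
where
  "success_prob n Pre Dec =
     measure_pmf.prob (pair_pmf (pmf_of_set (funs n)) (pmf_of_set {1..n}))
       {(f, x). invert Pre Dec (f x) f \<in> preimage n f (f x)}"

text \<open>The additive groups are abelian groups, in the multiplicative notation of
  \<^theory>\<open>HOL-Algebra.Group\<close>.\<close>

definition linear_pre :: "nat \<Rightarrow> nat \<Rightarrow> ((nat \<Rightarrow> nat) \<Rightarrow> bool list) \<Rightarrow> bool" where
  "linear_pre n s Pre \<longleftrightarrow>
     (\<exists>(G :: bool list monoid) (K :: nat monoid).
        comm_group G \<and> carrier G \<subseteq> {a. length a = s} \<and> Pre ` funs n \<subseteq> carrier G \<and>
        comm_group K \<and> carrier K = {1..n} \<and>
        (\<forall>f1\<in>funs n. \<forall>f2\<in>funs n.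
           Pre (\<lambda>i\<in>{1..n}. f1 i \<otimes>\<^bsub>K\<^esub> f2 i) = Pre f1 \<otimes>\<^bsub>G\<^esub> Pre f2))"


section \<open>Two-party protocols for set disjointness\<close>

text \<open>Each party's view consists of its input set, its private random string and the public
  random string. The transcript so far determines who sends the next bit; that bit is a function
  of the sender's view. At a leaf each party computes its output from its own view.\<close>

type_synonym view = "nat set \<times> bool list \<times> bool list"

datatype protocol_tree =
    Output "view \<Rightarrow> bool" "view \<Rightarrow> bool"
  | Send_A "view \<Rightarrow> bool" "bool \<Rightarrow> protocol_tree"
  | Send_B "view \<Rightarrow> bool" "bool \<Rightarrow> protocol_tree"

primrec outputs :: "view \<Rightarrow> view \<Rightarrow> protocol_tree \<Rightarrow> bool \<times> bool" where
  "outputs a b (Output g h) = (g a, h b)"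
| "outputs a b (Send_A m k) = outputs a b (k (m a))"
| "outputs a b (Send_B m k) = outputs a b (k (m b))"

primrec transcript :: "view \<Rightarrow> view \<Rightarrow> protocol_tree \<Rightarrow> bool list" where
  "transcript a b (Output g h) = []"
| "transcript a b (Send_A m k) = m a # transcript a b (k (m a))"
| "transcript a b (Send_B m k) = m b # transcript a b (k (m b))"

text \<open>The three random strings are independent, each with an arbitrary discrete distribution.\<close>

record protocol =
  coins_A :: "bool list pmf"
  coins_B :: "bool list pmf"
  coins_pub :: "bool list pmf"
  ptree :: protocol_tree

definition coins :: "protocol \<Rightarrow> (bool list \<times> bool list \<times> bool list) pmf" where
  "coins P = pair_pmf (coins_A P) (pair_pmf (coins_B P) (coins_pub P))"

definition correct_prob :: "protocol \<Rightarrow> nat set \<Rightarrow> nat set \<Rightarrow> real" where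
  "correct_prob P X Y =
     measure_pmf.prob (coins P)
       {(rA, rB, rp).
          outputs (X, rA, rp) (Y, rB, rp) (ptree P) = (X \<inter> Y = {}, X \<inter> Y = {})}"

definition solves_disjointness :: "protocol \<Rightarrow> real \<Rightarrow> (nat set \<times> nat set) set \<Rightarrow> bool" where
  "solves_disjointness P \<epsilon> Q \<longleftrightarrow> (\<forall>(X, Y)\<in>Q. correct_prob P X Y \<ge> 1 - \<epsilon>)"

definition one_sided :: "protocol \<Rightarrow> (nat set \<times> nat set) set \<Rightarrow> bool" where
  "one_sided P Q \<longleftrightarrow> (\<forall>(X, Y)\<in>Q. X \<inter> Y = {} \<longrightarrow> correct_prob P X Y = 1)"

definition comm_complexity :: "nat \<Rightarrow> protocol \<Rightarrow> enat" where
  "comm_complexity n P =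
     (SUP (X, Y, rA, rB, rp) \<in> {(X, Y, r). X \<subseteq> {1..n} \<and> Y \<subseteq> {1..n} \<and> r \<in> set_pmf (coins P)}.
        enat (length (transcript (X, rA, rp) (Y, rB, rp) (ptree P))))"

definition almost_disjoint_inputs :: "nat \<Rightarrow> (nat set \<times> nat set) set" where
  "almost_disjoint_inputs n =
     {(X, Y). X \<subseteq> {1..n} \<and> Y \<subseteq> {1..n} \<and> card (X \<inter> Y) \<le> 1}"

text \<open>The expression under the \<open>O\<close>. Each factor is read as at least 1, since the unguarded bound
  fails in degenerate cases: if \<open>s = q = 0\<close> (where an inverter with \<open>\<alpha> = 1/n\<close> exists), if
  \<open>n = 1\<close> and \<open>s = 0\<close>, or if \<open>\<epsilon>\<close> is close to or above 1, it drops below 1 or becomes negative,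
  whereas for \<open>\<epsilon> < 1\<close> at least one bit must be sent. The first guard is
  void for \<open>0 < \<alpha> \<le> 1\<close> and \<open>\<epsilon> \<le> 1 - \<alpha>\<^sup>2/8\<close>, the second one unless \<open>s = 0\<close> and (\<open>q = 0\<close> or \<open>n = 1\<close>).\<close>

definition comm_bound :: "nat \<Rightarrow> nat \<Rightarrow> nat \<Rightarrow> real \<Rightarrow> real \<Rightarrow> real" where
  "comm_bound n s q \<alpha> \<epsilon> =
     max 1 (log 2 \<epsilon> / log 2 (1 - \<alpha>\<^sup>2 / 8)) * max 1 (real s + real q * log 2 (real n))"

end

theory Submission
  imports Defs
begin

text \<open>From public coins (an image point \<open>y\<close>, two functions \<open>u\<close>, \<open>v\<close> and a shift \<open>z\<close>), A builds the
  function that is the neutral element where \<open>i + z \<in> X\<close> and \<open>u i\<close> elsewhere, and B the function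
  that is \<open>y\<close> where \<open>i + z \<in> Y\<close> and \<open>v i\<close> elsewhere. Linearity gives both parties the advice of the
  sum \<open>f\<close> of these functions for \<open>2s\<close> bits, and each oracle query to \<open>f\<close> costs \<open>2\<lceil>log n\<rceil>\<close> bits, so
  they can invert \<open>f\<close> at \<open>y\<close> together and test whether the shifted answer lies in both sets; this
  test never errs on disjoint sets. If \<open>X \<inter> Y = {e}\<close>, then \<open>f\<close> is uniform, independent of the uniform
  point \<open>x = e - z\<close>, and \<open>y = f x\<close>. Hence a round finds \<open>e\<close> with the probability that the inverter
  returns the very point \<open>x\<close> it was challenged with, which by Cauchy--Schwarz is at least \<open>\<alpha>\<^sup>2/2\<close>.
  Independent rounds amplify this.\<close>

declare One_nat_def [simp del]

section \<open>Communication protocols\<close>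

text \<open>The continuation \<open>K\<close> is the rest of the protocol, chosen by the two
  messages just sent. The length \<open>l\<close> is fixed in advance, so no delimiter has to be
  sent.\<close>

primrec exchange ::
  "nat \<Rightarrow> (view \<Rightarrow> bool list) \<Rightarrow> (view \<Rightarrow> bool list) \<Rightarrow>
     (bool list \<Rightarrow> bool list \<Rightarrow> protocol_tree) \<Rightarrow> protocol_tree"
where
  "exchange 0 m m' K = K [] []"
| "exchange (Suc l) m m' K =
     Send_A (\<lambda>a. hd (m a)) (\<lambda>x. Send_B (\<lambda>b. hd (m' b)) (\<lambda>y.
       exchange l (\<lambda>a. tl (m a)) (\<lambda>b. tl (m' b)) (\<lambda>xs ys. K (x # xs) (y # ys))))"

lemma outputs_exchange:
  assumes "length (m a) = l" "length (m' b) = l"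
  shows "outputs a b (exchange l m m' K) = outputs a b (K (m a) (m' b))"
  using assms
proof (induction l arbitrary: m m' K)
  case (Suc l)
  obtain x xs y ys where "m a = x # xs" "m' b = y # ys"
    using Suc.prems by (meson length_Suc_conv)
  then show ?case
    using Suc.IH[of "\<lambda>a. tl (m a)" "\<lambda>b. tl (m' b)"] Suc.prems by simp
qed simp

lemma length_transcript_exchange:
  assumes "length (m a) = l" "length (m' b) = l"
  shows "length (transcript a b (exchange l m m' K)) = 2 * l + length (transcript a b (K (m a) (m' b)))"
  using assms
proof (induction l arbitrary: m m' K)
  case (Suc l)
  obtain x xs y ys where "m a = x # xs" "m' b = y # ys"
    using Suc.prems by (meson length_Suc_conv)
  then show ?case
    using Suc.IH[of "\<lambda>a. tl (m a)" "\<lambda>b. tl (m' b)"] Suc.prems by simp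
qed simp

text \<open>The order in which the parties speak in a protocol tree cannot depend on the public coins.
  A family of trees indexed by the public coins is therefore turned into a single tree in which
  both parties speak in every step, the message of the one whose turn it is not being ignored.\<close>

primrec merge :: "nat \<Rightarrow> (bool list \<Rightarrow> protocol_tree) \<Rightarrow> protocol_tree" where
  "merge 0 T =
     Output (\<lambda>a. case T (snd (snd a)) of Output g h \<Rightarrow> g a | _ \<Rightarrow> False)
            (\<lambda>b. case T (snd (snd b)) of Output g h \<Rightarrow> h b | _ \<Rightarrow> False)"
| "merge (Suc c) T =
     Send_A (\<lambda>a. case T (snd (snd a)) of Send_A m k \<Rightarrow> m a | _ \<Rightarrow> False) (\<lambda>x.
     Send_B (\<lambda>b. case T (snd (snd b)) of Send_B m k \<Rightarrow> m b | _ \<Rightarrow> False) (\<lambda>y.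
       merge c (\<lambda>r. case T r of Output g h \<Rightarrow> Output g h | Send_A m k \<Rightarrow> k x | Send_B m k \<Rightarrow> k y)))"

lemma length_transcript_merge: "length (transcript a b (merge c T)) = 2 * c"
  by (induction c arbitrary: T) auto

text \<open>A tree that has reached its \<open>Output\<close> stays as it is while dummy bits fill
  the remaining steps, so any upper bound \<open>c\<close> on its transcript will do. Both views
  carry the same \<open>r\<close>, so the parties follow the same tree \<open>T r\<close>.\<close>

lemma outputs_merge:
  assumes "length (transcript (X, rA, r) (Y, rB, r) (T r)) \<le> c"
  shows "outputs (X, rA, r) (Y, rB, r) (merge c T) = outputs (X, rA, r) (Y, rB, r) (T r)"
  using assms
proof (induction c arbitrary: T)
  case 0
  then show ?case by (cases "T r") auto
next
  case (Suc c)
  then show ?case by (cases "T r") auto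
qed

section \<open>Joint evaluation of an oracle computation on a shared function\<close>

locale two_party_simulation =
  fixes L :: nat and code :: "nat \<Rightarrow> bool list" and S :: "nat set"
    and add :: "nat \<Rightarrow> nat \<Rightarrow> nat"
  assumes inj_code: "inj_on code S"
    and length_code: "x \<in> S \<Longrightarrow> length (code x) = L"
begin

text \<open>\<open>g\<close> and \<open>h\<close> give the two parties' shares of the oracle. Both
  shares of a queried value are sent in code, so both parties learn the answer and agree on the next
  query.\<close>

primrec simulate ::
  "(view \<Rightarrow> nat \<Rightarrow> nat) \<Rightarrow> (view \<Rightarrow> nat \<Rightarrow> nat) \<Rightarrow> (nat \<Rightarrow> protocol_tree) \<Rightarrow>
     oracle_tree \<Rightarrow> protocol_tree"
where
  "simulate g h K (Answer x) = K x"
| "simulate g h K (Query i k) =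
     exchange L (\<lambda>a. code (g a i)) (\<lambda>b. code (h b i))
       (\<lambda>xs ys. simulate g h K (k (add (inv_into S code xs) (inv_into S code ys))))"

text \<open>As long as every answer is right, the simulation stays on the path that \<open>t\<close>
  takes under \<open>f\<close>; this is why the shares are constrained only at the positions queried
  on that path.\<close>

lemma simulate_correct:
  assumes "\<And>i. i \<in> set (queries f t) \<Longrightarrow> g a i \<in> S \<and> h b i \<in> S \<and> f i = add (g a i) (h b i)"
  shows "outputs a b (simulate g h K t) = outputs a b (K (result f t))"
    and "length (transcript a b (simulate g h K t)) =
           2 * L * length (queries f t) + length (transcript a b (K (result f t)))"
proof -
  have "outputs a b (simulate g h K t) = outputs a b (K (result f t)) \<and>
        length (transcript a b (simulate g h K t)) =
           2 * L * length (queries f t) + length (transcript a b (K (result f t)))"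
    using assms
  proof (induction t)
    case (Query i k)
    have "g a i \<in> S" "h b i \<in> S" "f i = add (g a i) (h b i)"
      using Query.prems by auto
    moreover have "outputs a b (simulate g h K (k (f i))) = outputs a b (K (result f (k (f i)))) \<and>
        length (transcript a b (simulate g h K (k (f i)))) =
           2 * L * length (queries f (k (f i))) + length (transcript a b (K (result f (k (f i)))))"
      using Query.prems by (intro Query.IH) auto
    ultimately show ?case
      by (simp add: outputs_exchange length_transcript_exchange length_code inj_code algebra_simps)
  qed simp
  then show "outputs a b (simulate g h K t) = outputs a b (K (result f t))"
    and "length (transcript a b (simulate g h K t)) =
           2 * L * length (queries f t) + length (transcript a b (K (result f t)))"
    by auto
qed

end


section \<open>Exact inversion\<close>

lemma finite_funs: "finite (funs n)" and card_funs: "card (funs n) = n ^ n"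
  by (simp_all add: funs_def finite_PiE card_PiE)

text \<open>Overwriting the value at \<open>k\<close> of a colliding function by any of the
  \<open>n\<close> values loses no information: the old value can still be read off at
  \<open>j\<close>.\<close>

lemma card_collision_le:
  assumes "j \<in> {1..n}" "k \<in> {1..n}" "j \<noteq> k"
  shows "n * card {f \<in> funs n. f j = f k} \<le> card (funs n)"
proof -
  let ?C = "{f \<in> funs n. f j = f k}"
  have "inj_on (\<lambda>(f, t). f(k := t)) (?C \<times> {1..n})"
  proof (rule inj_onI, clarify)
    fix f t f' t'
    assume fj: "f j = f k" "f' j = f' k" and eq: "f(k := t) = f'(k := t')"
    have "f i = f' i" for i
      using fj fun_cong[OF eq, of i] fun_cong[OF eq, of j] assms(3) by (cases "i = k") auto
    then show "f = f' \<and> t = t'" using fun_cong[OF eq, of k] by auto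
  qed
  moreover have "(\<lambda>(f, t). f(k := t)) ` (?C \<times> {1..n}) \<subseteq> funs n"
    using assms by (auto simp: funs_def PiE_iff extensional_def)
  ultimately have "card (?C \<times> {1..n}) \<le> card (funs n)"
    using finite_funs by (rule card_inj_on_le)
  then show ?thesis by (simp add: card_cartesian_product mult.commute)
qed

text \<open>For each \<open>f\<close> the inner sum counts the pairs \<open>(j, k)\<close> with
  \<open>f j = f k\<close>. Summed over all functions, a diagonal pair contributes
  \<open>card (funs n)\<close> and any other pair at most a fraction \<open>1/n\<close> of
  that.\<close>

lemma sum_card_fibres_squared_le:
  "(\<Sum>f\<in>funs n. \<Sum>y\<in>{1..n}. (real (card (preimage n f y)))\<^sup>2) \<le> 2 * real n * card (funs n)"
proof -
  have coll: "real (card {f \<in> funs n. f j = f k}) \<le> (if j = k then card (funs n) else card (funs n) / n)"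
    if "j \<in> {1..n}" "k \<in> {1..n}" for j k
  proof (cases "j = k")
    case False
    have "real n * card {f \<in> funs n. f j = f k} \<le> card (funs n)"
      using card_collision_le[OF that False] unfolding of_nat_mult[symmetric] of_nat_le_iff .
    then show ?thesis using False that by (simp add: field_simps)
  qed simp
  have fibre: "(\<Sum>y\<in>{1..n}. (real (card (preimage n f y)))\<^sup>2) =
      (\<Sum>j\<in>{1..n}. \<Sum>k\<in>{1..n}. of_bool (f j = f k))" if "f \<in> funs n" for f
  proof -
    have card_eq: "real (card (preimage n f y)) = (\<Sum>j\<in>{1..n}. of_bool (f j = y))" for y
      by (simp add: preimage_def Int_def)
    have "(\<Sum>y\<in>{1..n}. (real (card (preimage n f y)))\<^sup>2) =
        (\<Sum>y\<in>{1..n}. \<Sum>j\<in>{1..n}. \<Sum>k\<in>{1..n}. of_bool (f j = y) * of_bool (f k = y))"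
      by (simp only: card_eq power2_eq_square sum_product)
    also have "\<dots> = (\<Sum>j\<in>{1..n}. \<Sum>k\<in>{1..n}. \<Sum>y\<in>{1..n}. of_bool (f j = y) * of_bool (f k = y))"
      by (subst sum.swap) (rule sum.cong[OF refl sum.swap])
    also have "\<dots> = (\<Sum>j\<in>{1..n}. \<Sum>k\<in>{1..n}. of_bool (f j = f k))"
    proof (intro sum.cong refl)
      fix j k assume "j \<in> {1..n}" "k \<in> {1..n}"
      then have "f j \<in> {1..n}" using that by (auto simp: funs_def PiE_iff)
      have "(\<Sum>y\<in>{1..n}. of_bool (f j = y) * of_bool (f k = y)) =
          (\<Sum>y\<in>{1..n}. if f j = y then of_bool (f k = f j) else (0::real))"
        by (intro sum.cong) auto
      then show "(\<Sum>y\<in>{1..n}. of_bool (f j = y) * of_bool (f k = y)) = (of_bool (f j = f k) :: real)"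
        using \<open>f j \<in> {1..n}\<close> by auto
    qed
    finally show ?thesis .
  qed
  have "(\<Sum>f\<in>funs n. \<Sum>y\<in>{1..n}. (real (card (preimage n f y)))\<^sup>2) =
      (\<Sum>f\<in>funs n. \<Sum>j\<in>{1..n}. \<Sum>k\<in>{1..n}. of_bool (f j = f k))"
    by (rule sum.cong[OF refl fibre])
  also have "\<dots> = (\<Sum>j\<in>{1..n}. \<Sum>k\<in>{1..n}. \<Sum>f\<in>funs n. of_bool (f j = f k))"
    by (subst sum.swap) (rule sum.cong[OF refl sum.swap])
  also have "\<dots> = (\<Sum>j\<in>{1..n}. \<Sum>k\<in>{1..n}. real (card {f \<in> funs n. f j = f k}))"
    by (simp add: finite_funs Int_def)
  \<comment> \<open>Granting the off-diagonal bound to the diagonal as well makes every row sum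
    exactly \<open>2 * card (funs n)\<close>.\<close>
  also have "\<dots> \<le> (\<Sum>j\<in>{1..n}. \<Sum>k\<in>{1..n}. (if j = k then real (card (funs n)) else 0) + card (funs n) / n)"
    by (intro sum_mono order.trans[OF coll]) auto
  also have "\<dots> = (\<Sum>j\<in>{1..n}. 2 * real (card (funs n)))"
    by (intro sum.cong) (auto simp: sum.distrib)
  finally show ?thesis by simp
qed

text \<open>By Cauchy--Schwarz over the pairs of a function and an image point: an image point that the
  inverter handles contributes the size of its fibre to \<open>Succ\<close>, but only 1 to \<open>Exact\<close>.\<close>

lemma card_exact_inversions_ge:
  fixes I :: "(nat \<Rightarrow> nat) \<Rightarrow> nat \<Rightarrow> nat" and n :: nat
  defines "Succ \<equiv> {(f, x). f \<in> funs n \<and> x \<in> {1..n} \<and> I f (f x) \<in> preimage n f (f x)}"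
  defines "Exact \<equiv> {(f, x). f \<in> funs n \<and> x \<in> {1..n} \<and> I f (f x) = x}"
  shows "(real (card Succ))\<^sup>2 \<le> real (card Exact) * (2 * real n * card (funs n))"
proof -
  let ?D = "funs n \<times> {1..n}"
  define good where "good = {(f, y). (f, y) \<in> ?D \<and> I f y \<in> preimage n f y}"
  let ?g = "\<lambda>p. of_bool (p \<in> good) :: real"
  let ?c = "\<lambda>(f, y). real (card (preimage n f y))"
  have fin: "finite ?D" "finite good"
    by (auto simp: finite_funs good_def intro: finite_subset[of _ ?D])
  have sub: "good \<subseteq> ?D" by (auto simp: good_def)
  \<comment> \<open>For a handled pair \<open>(f, y)\<close> the only challenge point that is
    answered exactly is the returned value \<open>I f y\<close> itself.\<close>
  have "bij_betw (\<lambda>(f, x). (f, f x)) Exact good"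
    by (rule bij_betw_byWitness[where f' = "\<lambda>(f, y). (f, I f y)"])
       (auto simp: Exact_def good_def preimage_def funs_def PiE_iff)
  then have card_good: "card Exact = card good" by (rule bij_betw_same_card)
  have "Succ \<subseteq> (\<lambda>((f, y), x). (f, x)) ` (SIGMA p:good. preimage n (fst p) (snd p))"
  proof
    fix p assume "p \<in> Succ"
    then obtain f x where fx: "p = (f, x)" "f \<in> funs n" "x \<in> {1..n}" "I f (f x) \<in> preimage n f (f x)"
      by (auto simp: Succ_def)
    then have "f x \<in> {1..n}" by (auto simp: funs_def)
    then have "((f, f x), x) \<in> (SIGMA p:good. preimage n (fst p) (snd p))"
      using fx by (simp add: good_def preimage_def)
    then show "p \<in> (\<lambda>((f, y), x). (f, x)) ` (SIGMA p:good. preimage n (fst p) (snd p))"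
      by (rule rev_image_eqI) (simp add: fx)
  qed
  moreover have "finite (SIGMA p:good. preimage n (fst p) (snd p))"
    using fin by (auto simp: preimage_def)
  ultimately have "card Succ \<le> card (SIGMA p:good. preimage n (fst p) (snd p))"
    by (rule surj_card_le[rotated])
  also have "\<dots> = (\<Sum>p\<in>good. card (preimage n (fst p) (snd p)))"
    using fin by (intro card_SigmaI) (auto simp: preimage_def)
  finally have "real (card Succ) \<le> (\<Sum>p\<in>good. ?c p)"
    by (simp add: case_prod_beta flip: of_nat_sum)
  also have "\<dots> = (\<Sum>p\<in>?D. ?g p * ?c p)"
    using fin sub by (intro sum.mono_neutral_cong_left) auto
  finally have "(real (card Succ))\<^sup>2 \<le> (\<Sum>p\<in>?D. ?g p * ?c p)\<^sup>2"
    by (simp add: power_mono)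
  also have "\<dots> \<le> (\<Sum>p\<in>?D. (?g p)\<^sup>2) * (\<Sum>p\<in>?D. (?c p)\<^sup>2)"
    by (rule Cauchy_Schwarz_ineq_sum)
  also have "(\<Sum>p\<in>?D. (?g p)\<^sup>2) = card Exact"
    using fin sub by (simp add: card_good power2_eq_square Int_absorb1 flip: of_bool_conj)
  also have "(\<Sum>p\<in>?D. (?c p)\<^sup>2) = (\<Sum>f\<in>funs n. \<Sum>y\<in>{1..n}. (real (card (preimage n f y)))\<^sup>2)"
    by (simp add: sum.cartesian_product case_prod_beta)
  finally show ?thesis
    using sum_card_fibres_squared_le[of n] by (meson mult_left_mono of_nat_0_le_iff order.trans)
qed

lemma success_prob_eq:
  assumes "n \<ge> 1"
  shows "success_prob n Pre Dec =
    card {(f, x). f \<in> funs n \<and> x \<in> {1..n} \<and> invert Pre Dec (f x) f \<in> preimage n f (f x)}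
      / (real n * card (funs n))"
proof -
  have ne: "funs n \<noteq> {}" using card_funs[of n] assms by force
  have "pair_pmf (pmf_of_set (funs n)) (pmf_of_set {1..n}) = pmf_of_set (funs n \<times> {1..n})"
  proof (rule pmf_eqI)
    fix p :: "(nat \<Rightarrow> nat) \<times> nat"
    show "pmf (pair_pmf (pmf_of_set (funs n)) (pmf_of_set {1..n})) p =
        pmf (pmf_of_set (funs n \<times> {1..n})) p"
      using ne assms finite_funs[of n]
      by (cases p) (simp add: pmf_pair indicator_def card_cartesian_product)
  qed
  then show ?thesis
    using ne assms unfolding success_prob_def
    by (simp add: measure_pmf_of_set finite_funs card_cartesian_product mult.commute)
       (auto intro!: arg_cong[of _ _ card])
qed


section \<open>The disjointness protocol\<close>

type_synonym seed = "nat \<times> (nat \<Rightarrow> nat) \<times> (nat \<Rightarrow> nat) \<times> nat"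

locale linear_inverter = two_party_simulation L code "{1..n}" "\<lambda>x y. x \<otimes>\<^bsub>K\<^esub> y" + K: comm_group K
  for n L :: nat and code :: "nat \<Rightarrow> bool list" and K :: "nat monoid" +
  fixes s q :: nat and Pre :: "(nat \<Rightarrow> nat) \<Rightarrow> bool list"
    and Dec :: "nat \<Rightarrow> bool list \<Rightarrow> oracle_tree" and G :: "bool list monoid"
  assumes n_pos: "n \<ge> 1"
    and inverter: "inverter n s q Pre Dec"
    and carrier_K: "carrier K = {1..n}"
    and Pre_add: "\<lbrakk>f1 \<in> funs n; f2 \<in> funs n\<rbrakk> \<Longrightarrow>
        Pre (\<lambda>i\<in>{1..n}. f1 i \<otimes>\<^bsub>K\<^esub> f2 i) = Pre f1 \<otimes>\<^bsub>G\<^esub> Pre f2"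
begin

section \<open>The shared function with a planted value\<close>

definition seeds :: "seed set" where
  "seeds = {1..n} \<times> funs n \<times> funs n \<times> {1..n}"

fun target :: "seed \<Rightarrow> nat" where "target (y, u, v, z) = y"

fun shift :: "seed \<Rightarrow> nat \<Rightarrow> nat" where "shift (y, u, v, z) i = i \<otimes>\<^bsub>K\<^esub> z"

fun share_A :: "seed \<Rightarrow> nat set \<Rightarrow> nat \<Rightarrow> nat" where
  "share_A (y, u, v, z) X = (\<lambda>i\<in>{1..n}. if i \<otimes>\<^bsub>K\<^esub> z \<in> X then \<one>\<^bsub>K\<^esub> else u i)"

fun share_B :: "seed \<Rightarrow> nat set \<Rightarrow> nat \<Rightarrow> nat" where
  "share_B (y, u, v, z) Y = (\<lambda>i\<in>{1..n}. if i \<otimes>\<^bsub>K\<^esub> z \<in> Y then y else v i)"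

text \<open>Where the shifted position lies in both sets, both masks are removed and the value is
  \<open>y\<close>; everywhere else at least one of the masks \<open>u i\<close>, \<open>v i\<close>
  remains and keeps the value uniform.\<close>

definition planted :: "seed \<Rightarrow> nat set \<Rightarrow> nat set \<Rightarrow> nat \<Rightarrow> nat" where
  "planted \<omega> X Y = (\<lambda>i\<in>{1..n}. share_A \<omega> X i \<otimes>\<^bsub>K\<^esub> share_B \<omega> Y i)"

text \<open>The inverter answers with a position of the shifted domain; \<open>shift\<close> carries
  it back to the universe of \<open>X\<close> and \<open>Y\<close>.\<close>

definition candidate :: "seed \<Rightarrow> nat set \<Rightarrow> nat set \<Rightarrow> nat" where
  "candidate \<omega> X Y = shift \<omega> (invert Pre Dec (target \<omega>) (planted \<omega> X Y))"

lemma mult_range: "x \<in> {1..n} \<Longrightarrow> y \<in> {1..n} \<Longrightarrow> x \<otimes>\<^bsub>K\<^esub> y \<in> {1..n}"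
  using K.m_closed carrier_K by blast

lemma one_range: "\<one>\<^bsub>K\<^esub> \<in> {1..n}"
  using K.one_closed carrier_K by blast

lemma share_funs:
  assumes "\<omega> \<in> seeds"
  shows "share_A \<omega> X \<in> funs n" "share_B \<omega> Y \<in> funs n"
proof -
  obtain y u v z where "\<omega> = (y, u, v, z)" by (cases \<omega>)
  then show "share_A \<omega> X \<in> funs n" "share_B \<omega> Y \<in> funs n"
    using assms one_range by (auto simp: seeds_def funs_def PiE_iff restrict_def extensional_def)
qed

lemma planted_funs: "\<omega> \<in> seeds \<Longrightarrow> planted \<omega> X Y \<in> funs n"
  using share_funs[of \<omega> X] share_funs[of \<omega> Y] mult_range
  by (auto simp: planted_def funs_def PiE_iff simp del: atLeastAtMost_iff)

section \<open>One round and its repetition\<close>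

definition round_tree :: "seed \<Rightarrow> protocol_tree \<Rightarrow> protocol_tree" where
  "round_tree \<omega> T =
     exchange s (\<lambda>a. Pre (share_A \<omega> (fst a))) (\<lambda>b. Pre (share_B \<omega> (fst b))) (\<lambda>p p'.
       simulate (\<lambda>a. share_A \<omega> (fst a)) (\<lambda>b. share_B \<omega> (fst b))
         (\<lambda>x. exchange (Suc 0) (\<lambda>a. [shift \<omega> x \<in> fst a]) (\<lambda>b. [shift \<omega> x \<in> fst b])
           (\<lambda>c c'. if c = [True] \<and> c' = [True] then Output (\<lambda>_. False) (\<lambda>_. False) else T))
         (Dec (target \<omega>) (p \<otimes>\<^bsub>G\<^esub> p')))"

definition round_length :: nat where
  "round_length = 2 * s + 2 * L * q + 2"

text \<open>The \<open>2 * s\<close> bits of \<open>round_length\<close> pay for the advice,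
  \<open>2 * L * q\<close> for the queries, and the last 2 for the membership test. A hit exhibits a
  common element, so the run may stop at once.\<close>

lemma round_tree:
  assumes \<omega>: "\<omega> \<in> seeds"
  shows "outputs (X, ra) (Y, rb) (round_tree \<omega> T) =
      (if candidate \<omega> X Y \<in> X \<inter> Y then (False, False) else outputs (X, ra) (Y, rb) T)"
    and "length (transcript (X, ra) (Y, rb) (round_tree \<omega> T)) \<le>
      round_length + length (transcript (X, ra) (Y, rb) T)"
proof -
  let ?f = "planted \<omega> X Y"
  let ?t = "Dec (target \<omega>) (Pre ?f)"
  \<comment> \<open>This is where linearity enters: neither party knows the planted function, yet
    the two advice strings combine to its advice.\<close>
  have Pre: "Pre (share_A \<omega> X) \<otimes>\<^bsub>G\<^esub> Pre (share_B \<omega> Y) = Pre ?f"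
    unfolding planted_def using Pre_add[OF share_funs[OF \<omega>]] by simp
  have len: "length (Pre (share_A \<omega> X)) = s" "length (Pre (share_B \<omega> Y)) = s" "length (Pre ?f) = s"
    using inverter share_funs[OF \<omega>] planted_funs[OF \<omega>] unfolding inverter_def by blast+
  have "target \<omega> \<in> {1..n}" using \<omega> by (auto simp: seeds_def)
  then have q: "set (queries ?f ?t) \<subseteq> {1..n}" "length (queries ?f ?t) \<le> q"
    using inverter planted_funs[OF \<omega>] len unfolding inverter_def by blast+
  have shares: "share_A \<omega> (fst (X, ra)) i \<in> {1..n} \<and> share_B \<omega> (fst (Y, rb)) i \<in> {1..n} \<and>
      ?f i = share_A \<omega> (fst (X, ra)) i \<otimes>\<^bsub>K\<^esub> share_B \<omega> (fst (Y, rb)) i"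
    if "i \<in> set (queries ?f ?t)" for i
    using share_funs[OF \<omega>, of X] share_funs[OF \<omega>, of Y] that q
    by (auto simp: planted_def funs_def PiE_iff simp del: atLeastAtMost_iff)
  note sim = simulate_correct[of ?f ?t "\<lambda>a. share_A \<omega> (fst a)" "(X, ra)" "\<lambda>b. share_B \<omega> (fst b)"
      "(Y, rb)", OF shares]
  show "outputs (X, ra) (Y, rb) (round_tree \<omega> T) =
      (if candidate \<omega> X Y \<in> X \<inter> Y then (False, False) else outputs (X, ra) (Y, rb) T)"
    unfolding round_tree_def
    by (subst outputs_exchange)
       (simp_all add: len Pre sim outputs_exchange candidate_def invert_def)
  \<comment> \<open>Only an upper bound, since a hit ends the run without entering
    \<open>T\<close>.\<close>
  have "length (transcript (X, ra) (Y, rb) (round_tree \<omega> T)) \<le>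
      2 * s + 2 * L * length (queries ?f ?t) + 2 + length (transcript (X, ra) (Y, rb) T)"
    unfolding round_tree_def
    by (subst length_transcript_exchange)
       (simp_all add: len Pre sim length_transcript_exchange)
  moreover have "2 * L * length (queries ?f ?t) \<le> 2 * L * q"
    using q by simp
  ultimately show "length (transcript (X, ra) (Y, rb) (round_tree \<omega> T)) \<le>
      round_length + length (transcript (X, ra) (Y, rb) T)"
    unfolding round_length_def by linarith
qed

text \<open>The default verdict is disjointness, and only a common element actually found overturns
  it; hence the error is one-sided.\<close>

definition rounds :: "seed list \<Rightarrow> protocol_tree" where
  "rounds \<omega>s = foldr round_tree \<omega>s (Output (\<lambda>_. True) (\<lambda>_. True))"

lemma rounds:
  assumes "set \<omega>s \<subseteq> seeds"
  shows "outputs (X, ra) (Y, rb) (rounds \<omega>s) =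
      ((\<forall>\<omega>\<in>set \<omega>s. candidate \<omega> X Y \<notin> X \<inter> Y), (\<forall>\<omega>\<in>set \<omega>s. candidate \<omega> X Y \<notin> X \<inter> Y))"
    and "length (transcript (X, ra) (Y, rb) (rounds \<omega>s)) \<le> length \<omega>s * round_length"
proof -
  show "outputs (X, ra) (Y, rb) (rounds \<omega>s) =
      ((\<forall>\<omega>\<in>set \<omega>s. candidate \<omega> X Y \<notin> X \<inter> Y), (\<forall>\<omega>\<in>set \<omega>s. candidate \<omega> X Y \<notin> X \<inter> Y))"
    using assms by (induction \<omega>s) (auto simp: rounds_def round_tree)
  show "length (transcript (X, ra) (Y, rb) (rounds \<omega>s)) \<le> length \<omega>s * round_length"
    using assms
  proof (induction \<omega>s)
    case (Cons \<omega> \<omega>s)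
    then show ?case
      using round_tree(2)[of \<omega> X ra Y rb "rounds \<omega>s"] by (simp add: rounds_def)
  qed (simp add: rounds_def)
qed

section \<open>Detection probability of a single round\<close>

lemma finite_seeds: "finite seeds" and card_seeds: "card seeds = n * card (funs n) * (n * card (funs n))"
  by (simp_all add: seeds_def finite_funs card_cartesian_product)

text \<open>The planted function together with the shifted position of the common element is uniformly
  distributed: the seeds biject with it and the unused part of the randomness.\<close>

lemma card_detecting_seeds_ge:
  assumes XY: "X \<inter> Y = {e}" "e \<in> {1..n}"
  shows "card {(f, x). f \<in> funs n \<and> x \<in> {1..n} \<and> invert Pre Dec (f x) f = x} * (n * card (funs n)) \<le>
    card {\<omega> \<in> seeds. candidate \<omega> X Y \<in> X \<inter> Y}" (is "card ?E * _ \<le> card ?D")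
proof -
  \<comment> \<open>The position that the shift by \<open>z\<close> moves onto the common
    element.\<close>
  define pos where "pos z = e \<otimes>\<^bsub>K\<^esub> inv\<^bsub>K\<^esub> z" for z
  \<comment> \<open>One mask per position: \<open>u i\<close> where A has removed it, and otherwise
    \<open>v i\<close>, from which the planted value determines \<open>u i\<close>.\<close>
  define unused :: "seed \<Rightarrow> nat \<Rightarrow> nat" where "unused = (\<lambda>(y, u, v, z). \<lambda>i\<in>{1..n}.
      if i \<otimes>\<^bsub>K\<^esub> z \<in> X then u i else (v i :: nat))"
  define \<phi> where "\<phi> = (\<lambda>(y, u, v, z).
      ((planted (y, u, v, z) X Y, pos z), (unused (y, u, v, z), v (pos z))))"
  let ?R = "(funs n \<times> {1..n}) \<times> (funs n \<times> {1..n})"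
  have pos: "pos z \<in> {1..n}" "pos z \<otimes>\<^bsub>K\<^esub> z = e" if "z \<in> {1..n}" for z
  proof -
    have "z \<in> carrier K" "e \<in> carrier K" using that XY by (simp_all add: carrier_K)
    then show "pos z \<in> {1..n}" "pos z \<otimes>\<^bsub>K\<^esub> z = e"
      unfolding pos_def carrier_K[symmetric] by (simp_all add: K.m_assoc)
  qed
  have pos_iff: "i \<otimes>\<^bsub>K\<^esub> z = e \<longleftrightarrow> i = pos z" if "i \<in> {1..n}" "z \<in> {1..n}" for i z
    using that pos[OF that(2)] carrier_K by (metis K.right_cancel)
  have planted_at: "planted (y, u, v, z) X Y i =
      (if i \<otimes>\<^bsub>K\<^esub> z \<in> X then \<one>\<^bsub>K\<^esub> else u i) \<otimes>\<^bsub>K\<^esub> (if i \<otimes>\<^bsub>K\<^esub> z \<in> Y then y else v i)"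
    if "i \<in> {1..n}" for y u v z i
    using that by (simp add: planted_def)
  have planted_pos: "planted (y, u, v, z) X Y (pos z) = y" if "(y, u, v, z) \<in> seeds" for y u v z
    using that pos[of z] XY planted_at[of "pos z"] carrier_K by (auto simp: seeds_def)
  \<comment> \<open>A seed is recovered in this order: \<open>z\<close> from \<open>pos z\<close>,
    then \<open>y\<close> as the planted value at that position, then \<open>u\<close> and
    \<open>v\<close> pointwise by cancellation in \<open>K\<close>.\<close>
  have inj: "inj_on \<phi> seeds"
  proof (rule inj_onI)
    fix \<omega> \<omega>' assume in_seeds: "\<omega> \<in> seeds" "\<omega>' \<in> seeds" and eq: "\<phi> \<omega> = \<phi> \<omega>'"
    obtain y u v z y' u' v' z' where \<omega>: "\<omega> = (y, u, v, z)" "\<omega>' = (y', u', v', z')"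
      by (cases \<omega>, cases \<omega>')
    have funs: "u \<in> funs n" "v \<in> funs n" "u' \<in> funs n" "v' \<in> funs n"
      and range: "y \<in> {1..n}" "z \<in> {1..n}" "y' \<in> {1..n}" "z' \<in> {1..n}"
      using in_seeds by (auto simp: \<omega> seeds_def)
    have eqs: "planted \<omega> X Y = planted \<omega>' X Y" "pos z = pos z'" "unused \<omega> = unused \<omega>'"
      "v (pos z) = v' (pos z')"
      using eq by (auto simp: \<phi>_def \<omega>)
    have z: "z = z'"
    proof -
      have "pos z \<otimes>\<^bsub>K\<^esub> z = pos z \<otimes>\<^bsub>K\<^esub> z'"
        using pos(2)[OF range(2)] pos(2)[OF range(4)] eqs(2) by simp
      then show ?thesis
        using pos(1)[OF range(2)] range(2,4) unfolding carrier_K[symmetric] by simp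
    qed
    have y: "y = y'"
      using planted_pos in_seeds eqs(1) z unfolding \<omega> by metis
    have "u i = u' i \<and> v i = v' i" if i: "i \<in> {1..n}" for i
    proof -
      have K: "u i \<in> carrier K" "v i \<in> carrier K" "u' i \<in> carrier K" "v' i \<in> carrier K"
        "y \<in> carrier K"
        using funs range i unfolding carrier_K funs_def by blast+
      have P: "planted (y, u, v, z) X Y i = planted (y, u', v', z) X Y i"
        using eqs(1) by (simp add: \<omega> y z)
      have U: "unused (y, u, v, z) i = unused (y, u', v', z) i"
        using eqs(3) by (simp add: \<omega> y z)
      show ?thesis
      proof (cases "i \<otimes>\<^bsub>K\<^esub> z \<in> X")
        case True
        then have "u i = u' i" using U i by (simp add: unused_def)
        moreover have "v i = v' i"
        proof (cases "i \<otimes>\<^bsub>K\<^esub> z \<in> Y")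
          \<comment> \<open>Since \<open>e\<close> is the only common element, this happens at
            \<open>pos z\<close> alone, where \<open>v\<close> was recorded separately.\<close>
          case True
          then have "i = pos z" using \<open>i \<otimes>\<^bsub>K\<^esub> z \<in> X\<close> XY pos_iff[OF i range(2)] by auto
          then show ?thesis using eqs z by simp
        next
          case False
          then show ?thesis using P True K i by (simp add: planted_at)
        qed
        ultimately show ?thesis ..
      next
        case False
        then have "v i = v' i" using U i by (simp add: unused_def)
        then show ?thesis using P False K i by (auto simp: planted_at split: if_splits)
      qed
    qed
    then have "u = u'" "v = v'"
      using funs unfolding funs_def by (meson PiE_ext)+
    then show "\<omega> = \<omega>'" by (simp add: \<omega> y z)
  qed
  have "\<phi> \<omega> \<in> ?R" if "\<omega> \<in> seeds" for \<omega>
    using that planted_funs[OF that, of X Y] pos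
    by (auto simp: seeds_def \<phi>_def unused_def funs_def PiE_iff extensional_def
        simp del: atLeastAtMost_iff)
  then have "\<phi> ` seeds \<subseteq> ?R" by (rule image_subsetI)
  \<comment> \<open>Both sides have \<open>(n * card (funs n))^2\<close> elements, so injectivity
    already gives surjectivity.\<close>
  then have image: "\<phi> ` seeds = ?R"
    using inj by (intro card_subset_eq)
      (simp_all add: finite_funs card_image card_seeds card_cartesian_product mult.commute)
  have detect: "\<omega> \<in> ?D" if "\<omega> \<in> seeds" "fst (\<phi> \<omega>) \<in> ?E" for \<omega>
  proof -
    obtain y u v z where \<omega>: "\<omega> = (y, u, v, z)" by (cases \<omega>)
    have "z \<in> {1..n}" using that by (simp add: \<omega> seeds_def)
    then have "candidate \<omega> X Y = e"
      using that planted_pos[of y u v z] pos(2)[of z] by (simp add: candidate_def \<phi>_def \<omega>)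
    then show ?thesis using that XY by simp
  qed
  \<comment> \<open>Every exact inversion, paired with any value of the leftover randomness, comes
    from a seed that detects \<open>e\<close>.\<close>
  have "?E \<times> (funs n \<times> {1..n}) \<subseteq> \<phi> ` ?D"
  proof (intro subsetI)
    fix p assume p: "p \<in> ?E \<times> (funs n \<times> {1..n})"
    then have fst_p: "fst p \<in> ?E" and snd_p: "snd p \<in> funs n \<times> {1..n}"
      by (simp_all only: mem_Times_iff)
    have "?E \<subseteq> funs n \<times> {1..n}" by auto
    then have "p \<in> ?R" using fst_p snd_p by (simp only: mem_Times_iff[of p] subset_iff)
    then obtain \<omega> where \<omega>: "\<omega> \<in> seeds" "p = \<phi> \<omega>" unfolding image[symmetric] by (rule imageE)
    have "\<omega> \<in> ?D" using fst_p unfolding \<omega>(2) by (rule detect[OF \<omega>(1)])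
    then show "p \<in> \<phi> ` ?D" using \<omega>(2) by (rule rev_image_eqI)
  qed
  moreover have "finite ?D" using finite_seeds by simp
  ultimately have "card (?E \<times> (funs n \<times> {1..n})) \<le> card ?D"
    by (meson card_image_le card_mono finite_imageI order.trans)
  then show ?thesis by (simp add: card_cartesian_product mult.commute)
qed

text \<open>With \<open>N\<close> pairs of function and point there are \<open>N^2\<close> seeds, at
  least a fraction \<open>\<alpha>^2 / 2\<close> of which detect \<open>e\<close>. This is weakened
  to the \<open>\<alpha>^2 / 8\<close> of the communication bound.\<close>

lemma card_failing_seeds_le:
  assumes succ: "success_prob n Pre Dec \<ge> \<alpha>" and "\<alpha> > 0"
    and XY: "X \<inter> Y = {e}" "e \<in> {1..n}"
  shows "real (card {\<omega> \<in> seeds. candidate \<omega> X Y \<notin> X \<inter> Y}) \<le> (1 - \<alpha>\<^sup>2 / 8) * card seeds"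
proof -
  let ?E = "{(f, x). f \<in> funs n \<and> x \<in> {1..n} \<and> invert Pre Dec (f x) f = x}"
  let ?S = "{(f, x). f \<in> funs n \<and> x \<in> {1..n} \<and> invert Pre Dec (f x) f \<in> preimage n f (f x)}"
  let ?D = "{\<omega> \<in> seeds. candidate \<omega> X Y \<in> X \<inter> Y}"
  let ?F = "{\<omega> \<in> seeds. candidate \<omega> X Y \<notin> X \<inter> Y}"
  define N where "N = real n * card (funs n)"
  have "N > 0" using n_pos by (simp add: N_def card_funs)
  have "\<alpha> * N \<le> card ?S"
    using succ success_prob_eq[OF n_pos, of Pre Dec] \<open>N > 0\<close> by (simp add: N_def field_simps)
  then have "(\<alpha> * N)\<^sup>2 \<le> (real (card ?S))\<^sup>2"
    using \<open>\<alpha> > 0\<close> \<open>N > 0\<close> by (intro power_mono) auto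
  also have "\<dots> \<le> card ?E * (2 * N)"
    using card_exact_inversions_ge[of n "\<lambda>f y. invert Pre Dec y f"] by (simp add: N_def mult.assoc)
  finally have "\<alpha>\<^sup>2 / 2 * N\<^sup>2 \<le> card ?E * N" by (simp add: power_mult_distrib)
  also have "\<dots> \<le> card ?D"
    unfolding N_def of_nat_mult[symmetric] of_nat_le_iff by (rule card_detecting_seeds_ge[OF XY])
  finally have D: "\<alpha>\<^sup>2 / 2 * card seeds \<le> card ?D"
    by (simp add: card_seeds N_def power2_eq_square)
  have "card seeds = card ?D + card ?F"
    using finite_seeds by (subst card_Un_disjoint[symmetric]) (auto intro!: arg_cong[of _ _ card])
  then have "real (card seeds) = card ?D + card ?F"
    by simp
  moreover have "\<alpha>\<^sup>2 / 8 * card seeds \<le> \<alpha>\<^sup>2 / 2 * card seeds"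
    by (intro mult_right_mono) auto
  ultimately show ?thesis using D by (simp add: algebra_simps)
qed

section \<open>Amplification by independent rounds\<close>

lemma repeated_protocol:
  assumes succ: "success_prob n Pre Dec \<ge> \<alpha>" "\<alpha> > 0"
  shows "\<exists>P. solves_disjointness P ((1 - \<alpha>\<^sup>2 / 8) ^ k) (almost_disjoint_inputs n) \<and>
    one_sided P (almost_disjoint_inputs n) \<and>
    comm_complexity n P \<le> enat (2 * (k * round_length))"
proof -
  define \<Omega> where "\<Omega> = {\<omega>s. set \<omega>s \<subseteq> seeds \<and> length \<omega>s = k}"
  have \<Omega>: "finite \<Omega>" "card \<Omega> = card seeds ^ k" "card \<Omega> > 0"
    using finite_seeds n_pos unfolding \<Omega>_def
    by (simp_all add: finite_lists_length_eq card_lists_length_eq card_seeds card_funs)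
  then have "\<Omega> \<noteq> {}" by auto
  \<comment> \<open>Public coins are bit strings, so lists of seeds are numbered and written in
    unary; the length of the coins does not count as communication.\<close>
  obtain enc0 :: "seed list \<Rightarrow> nat" where "inj_on enc0 \<Omega>"
    using finite_imp_inj_to_nat_seg[OF \<Omega>(1)] by blast
  then have inj: "inj_on (\<lambda>\<omega>s. replicate (enc0 \<omega>s) True) \<Omega>" (is "inj_on ?enc _")
    by (simp add: inj_on_def)
  define P where "P = \<lparr>coins_A = return_pmf [], coins_B = return_pmf [],
    coins_pub = map_pmf ?enc (pmf_of_set \<Omega>),
    ptree = merge (k * round_length) (\<lambda>r. rounds (inv_into \<Omega> ?enc r))\<rparr>"
  have coins: "coins P = map_pmf (\<lambda>\<omega>s. ([], [], ?enc \<omega>s)) (pmf_of_set \<Omega>)"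
    by (simp add: coins_def P_def pair_return_pmf1 map_pmf_comp)
  have run: "outputs (X, [], ?enc \<omega>s) (Y, [], ?enc \<omega>s) (ptree P) =
      ((\<forall>\<omega>\<in>set \<omega>s. candidate \<omega> X Y \<notin> X \<inter> Y), (\<forall>\<omega>\<in>set \<omega>s. candidate \<omega> X Y \<notin> X \<inter> Y))"
    if "\<omega>s \<in> \<Omega>" for \<omega>s X Y
  proof -
    have inv: "inv_into \<Omega> ?enc (?enc \<omega>s) = \<omega>s"
      using inj that by (rule inv_into_f_f)
    have seeds: "set \<omega>s \<subseteq> seeds" "length \<omega>s = k"
      using that by (simp_all add: \<Omega>_def)
    note rounds = rounds[OF seeds(1), of X "([], ?enc \<omega>s)" Y "([], ?enc \<omega>s)", unfolded seeds(2)]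
    have "outputs (X, [], ?enc \<omega>s) (Y, [], ?enc \<omega>s) (ptree P) =
        outputs (X, [], ?enc \<omega>s) (Y, [], ?enc \<omega>s) (rounds (inv_into \<Omega> ?enc (?enc \<omega>s)))"
      unfolding P_def protocol.select_convs
      by (rule outputs_merge) (simp only: inv rounds(2))
    then show ?thesis by (simp only: inv rounds(1))
  qed
  have correct: "correct_prob P X Y = card {\<omega>s \<in> \<Omega>.
      (\<forall>\<omega>\<in>set \<omega>s. candidate \<omega> X Y \<notin> X \<inter> Y) = (X \<inter> Y = {})} / card \<Omega>" for X Y
    unfolding correct_prob_def coins using \<open>\<Omega> \<noteq> {}\<close> \<Omega>(1)
    by (simp add: measure_pmf_of_set)
       (auto simp: run intro!: arg_cong[of _ _ card])
  have disjoint: "correct_prob P X Y = 1" if "X \<inter> Y = {}" for X Y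
    using that \<Omega> by (simp add: correct)
  have "correct_prob P X Y \<ge> 1 - (1 - \<alpha>\<^sup>2 / 8) ^ k"
    if XY: "X \<subseteq> {1..n}" "card (X \<inter> Y) \<le> 1" "X \<inter> Y \<noteq> {}" for X Y
  proof -
    have "finite (X \<inter> Y)" using XY(1) finite_subset by blast
    then have "card (X \<inter> Y) \<noteq> 0" using XY(3) by simp
    then have "card (X \<inter> Y) = 1" using XY(2) by linarith
    then obtain e where e: "X \<inter> Y = {e}" by (rule card_1_singletonE)
    let ?F = "{\<omega> \<in> seeds. candidate \<omega> X Y \<notin> X \<inter> Y}"
    let ?B = "{\<omega>s \<in> \<Omega>. \<forall>\<omega>\<in>set \<omega>s. candidate \<omega> X Y \<notin> X \<inter> Y}"
    let ?C = "{\<omega>s \<in> \<Omega>. \<not> (\<forall>\<omega>\<in>set \<omega>s. candidate \<omega> X Y \<notin> X \<inter> Y)}"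
    \<comment> \<open>Independence of the rounds in counting form: the failing lists are exactly the
      lists of failing seeds, so the failure probability is a \<open>k\<close>-th power.\<close>
    have "?B = {\<omega>s. set \<omega>s \<subseteq> ?F \<and> length \<omega>s = k}" by (auto simp: \<Omega>_def)
    then have "card ?B = card ?F ^ k" using finite_seeds by (simp add: card_lists_length_eq)
    moreover have "e \<in> {1..n}" using e XY(1) by blast
    then have "real (card ?F) ^ k \<le> ((1 - \<alpha>\<^sup>2 / 8) * card seeds) ^ k"
      by (intro power_mono card_failing_seeds_le[OF succ e] of_nat_0_le_iff)
    ultimately have "real (card ?B) \<le> ((1 - \<alpha>\<^sup>2 / 8) * card seeds) ^ k"
      by simp
    then have B: "real (card ?B) \<le> (1 - \<alpha>\<^sup>2 / 8) ^ k * card \<Omega>"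
      by (simp add: \<Omega> power_mult_distrib)
    have "card \<Omega> = card ?B + card ?C"
      using \<Omega>(1) by (subst card_Un_disjoint[symmetric]) (auto intro!: arg_cong[of _ _ card])
    then have "real (card \<Omega>) = card ?B + card ?C" by simp
    then show ?thesis
      using B XY(3) \<Omega>(3) by (simp add: correct field_simps)
  qed
  note intersecting = this
  \<comment> \<open>On disjoint inputs the answer is always correct, and the claimed bound then
    amounts to this nonnegativity.\<close>
  have nonneg: "(1 - \<alpha>\<^sup>2 / 8) ^ k \<ge> 0"
  proof -
    have "\<alpha> \<le> 1" using succ(1) unfolding success_prob_def by (meson measure_pmf.prob_le_1 order.trans)
    then have "\<alpha>\<^sup>2 \<le> 1" using succ(2) by (simp add: power_le_one)
    then show ?thesis by simp
  qed
  have "correct_prob P X Y \<ge> 1 - (1 - \<alpha>\<^sup>2 / 8) ^ k" if "X \<subseteq> {1..n}" "card (X \<inter> Y) \<le> 1" for X Y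
    using that intersecting[of X Y] disjoint[of X Y] nonneg by (cases "X \<inter> Y = {}") auto
  then have "solves_disjointness P ((1 - \<alpha>\<^sup>2 / 8) ^ k) (almost_disjoint_inputs n)"
    by (auto simp: solves_disjointness_def almost_disjoint_inputs_def)
  moreover have "one_sided P (almost_disjoint_inputs n)"
    using disjoint by (simp add: one_sided_def)
  moreover have "comm_complexity n P \<le> enat (2 * (k * round_length))"
    unfolding comm_complexity_def by (rule SUP_least) (auto simp: P_def length_transcript_merge)
  ultimately show ?thesis by blast
qed

end

section \<open>The number of rounds and the constant\<close>

lemma power_ceiling_log_le:
  fixes \<beta> \<epsilon> :: real
  assumes "0 < \<beta>" "\<beta> < 1" "\<epsilon> > 0"
  shows "\<beta> ^ nat \<lceil>log 2 \<epsilon> / log 2 \<beta>\<rceil> \<le> \<epsilon>"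
proof -
  define k where "k = nat \<lceil>log 2 \<epsilon> / log 2 \<beta>\<rceil>"
  have "log 2 \<beta> < 0" using assms by simp
  moreover have "log 2 \<epsilon> / log 2 \<beta> \<le> k" unfolding k_def by linarith
  \<comment> \<open>Multiplying by the negative \<open>log 2 \<beta>\<close> reverses the
    inequality, so rounding the exponent up errs on the right side.\<close>
  ultimately have "k * log 2 \<beta> \<le> log 2 \<epsilon>" by (simp add: neg_divide_le_eq)
  then have "log 2 (\<beta> ^ k) \<le> log 2 \<epsilon>" using assms by (simp add: log_nat_power)
  then show ?thesis using assms unfolding k_def[symmetric] by simp
qed

theorem theorem4p6:
  "\<exists>C::real. C > 0 \<and>
     (\<forall>(n::nat) (s::nat) (q::nat) (\<alpha>::real) Pre Dec.
        n \<ge> 1 \<longrightarrow> \<alpha> > 0 \<longrightarrow>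
        inverter n s q Pre Dec \<longrightarrow> linear_pre n s Pre \<longrightarrow>
        success_prob n Pre Dec \<ge> \<alpha> \<longrightarrow>
        (\<forall>\<epsilon>::real. \<epsilon> > 0 \<longrightarrow>
           (\<exists>P. solves_disjointness P \<epsilon> (almost_disjoint_inputs n) \<and>
                one_sided P (almost_disjoint_inputs n) \<and>
                ereal_of_enat (comm_complexity n P) \<le> ereal (C * comm_bound n s q \<alpha> \<epsilon>))))"
proof (intro exI[of _ 24] conjI allI impI)
  fix n s q :: nat and \<alpha> \<epsilon> :: real and Pre :: "(nat \<Rightarrow> nat) \<Rightarrow> bool list" and Dec
  assume n: "n \<ge> 1" and \<alpha>: "\<alpha> > 0" and inv: "inverter n s q Pre Dec" and lin: "linear_pre n s Pre"
    and succ: "success_prob n Pre Dec \<ge> \<alpha>" and \<epsilon>: "\<epsilon> > 0"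
  define L where "L = nat \<lceil>log 2 n\<rceil>"
  have "log 2 n \<le> L" unfolding L_def by linarith
  then have "2 powr log 2 n \<le> 2 powr L" by simp
  then have "real n \<le> real (2 ^ L)" using n by (simp add: powr_realpow)
  then have "n \<le> 2 ^ L" by (simp only: of_nat_le_iff)
  moreover have "card {bs :: bool list. set bs \<subseteq> UNIV \<and> length bs = L} = 2 ^ L"
    by (subst card_lists_length_eq) (simp_all add: card_UNIV_bool)
  ultimately have "card {1..n} \<le> card {bs :: bool list. set bs \<subseteq> UNIV \<and> length bs = L}"
    by (simp only: card_atLeastAtMost diff_Suc_1)
  note card_le_inj[OF finite_atLeastAtMost finite_lists_length_eq[OF finite] this]
  then obtain code :: "nat \<Rightarrow> bool list"
    where code: "code ` {1..n} \<subseteq> {bs. set bs \<subseteq> UNIV \<and> length bs = L}" "inj_on code {1..n}"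
    by (elim exE conjE)
  obtain G :: "bool list monoid" and K :: "nat monoid" where
    "comm_group K" "carrier K = {1..n}"
    "\<forall>f1\<in>funs n. \<forall>f2\<in>funs n. Pre (\<lambda>i\<in>{1..n}. f1 i \<otimes>\<^bsub>K\<^esub> f2 i) = Pre f1 \<otimes>\<^bsub>G\<^esub> Pre f2"
    using lin unfolding linear_pre_def by blast
  then interpret linear_inverter n L code K s q Pre Dec G
    using n inv code
    by (intro linear_inverter.intro two_party_simulation.intro linear_inverter_axioms.intro)
      (auto simp: image_subset_iff)
  define \<beta> where "\<beta> = 1 - \<alpha>\<^sup>2 / 8"
  have "\<alpha> \<le> 1" using succ unfolding success_prob_def by (meson measure_pmf.prob_le_1 order.trans)
  then have "\<alpha>\<^sup>2 \<le> 1" using \<alpha> by (simp add: power_le_one)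
  then have \<beta>: "0 < \<beta>" "\<beta> < 1" using \<alpha> by (auto simp: \<beta>_def)
  define k where "k = nat \<lceil>log 2 \<epsilon> / log 2 \<beta>\<rceil>"
  obtain P where P: "solves_disjointness P (\<beta> ^ k) (almost_disjoint_inputs n)"
    "one_sided P (almost_disjoint_inputs n)" "comm_complexity n P \<le> enat (2 * (k * round_length))"
    using repeated_protocol[OF succ \<alpha>] unfolding \<beta>_def by blast
  have "solves_disjointness P \<epsilon> (almost_disjoint_inputs n)"
    using P(1) power_ceiling_log_le[OF \<beta> \<epsilon>] unfolding solves_disjointness_def k_def by fastforce
  \<comment> \<open>The constant is \<open>24 = 2 * 2 * 6\<close>: a factor 2 from
    \<open>merge\<close>, 2 from rounding up the number of rounds, and 6 from the length of a
    round.\<close>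
  moreover have "real (2 * (k * round_length)) \<le> 24 * comm_bound n s q \<alpha> \<epsilon>"
  proof -
    have k: "real k \<le> 2 * max 1 (log 2 \<epsilon> / log 2 \<beta>)" unfolding k_def by linarith
    \<comment> \<open>Rounding up at most doubles a number that is at least 1; for
      \<open>n = 1\<close> both sides are 0.\<close>
    have L: "real L \<le> 2 * log 2 n"
    proof (cases "n = 1")
      case False
      then have "log 2 n \<ge> 1" using n by (simp add: le_log_iff)
      then show ?thesis unfolding L_def by linarith
    qed (simp add: L_def)
    have "real L * q \<le> 2 * log 2 n * q" using L by (intro mult_right_mono) auto
    then have "real round_length \<le> 2 * real s + 4 * (q * log 2 n) + 2"
      by (simp add: round_length_def algebra_simps)
    also have "\<dots> \<le> 4 * (s + q * log 2 n) + 2" by simp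
    \<comment> \<open>The guard \<open>max 1\<close> absorbs the two bits of the membership
      test.\<close>
    also have "\<dots> \<le> 4 * max 1 (s + q * log 2 n) + 2 * max 1 (s + q * log 2 n)"
      by (intro add_mono mult_left_mono max.cobounded2) simp_all
    finally have r: "real round_length \<le> 6 * max 1 (s + q * log 2 n)" by simp
    have "real k * round_length \<le>
        (2 * max 1 (log 2 \<epsilon> / log 2 \<beta>)) * (6 * max 1 (s + q * log 2 n))"
      using k r by (intro mult_mono) auto
    then show ?thesis by (simp add: comm_bound_def \<beta>_def mult.commute)
  qed
  moreover have "ereal_of_enat (comm_complexity n P) \<le> ereal (real (2 * (k * round_length)))"
    using P(3) by (metis ereal_of_enat_le_iff ereal_of_enat_simps(1))
  ultimately show "\<exists>P. solves_disjointness P \<epsilon> (almost_disjoint_inputs n) \<and>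
      one_sided P (almost_disjoint_inputs n) \<and>
      ereal_of_enat (comm_complexity n P) \<le> ereal (24 * comm_bound n s q \<alpha> \<epsilon>)"
    using P(2) by (meson ereal_less_eq(3) order.trans)
qed simp

end
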